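(* Let $f:\mathbb R^d\to\mathbb R$ be convex and $(\delta_f,L_f)$-approximately smooth with components $(\bar f,\bar g)$, and let $\hat g$ be an unbiased stochastic oracle for $\bar g$. Consider the stepsize update rule $\hat M_+=M_+(M,\Omega,x,\hat x_+,\hat g_x,\hat g_{x_+})$ defined as the solution of the equation $$(\hat M_+-M)\Omega=[\hat\Delta_1(\hat M_+)]_+,\qquad\hat\Delta_1(\hat M_+):=\langle\hat g_{x_+}-\hat g_x,\hat x_+-x\rangle-\frac{\hat M_+}{2}\|\hat x_+-x\|^2.$$ Then this rule satisfies the requirement (R) of the context with $c_1=1$, $c_2=2$, $c_3=6$, $c_4=2$; that is, $\hat M_+\ge M$ and, for any $\bar M>2L_f$, $$\mathbb E[\hat\Delta(\hat M_+)+(\hat M_+-M)\Omega+\beta(\hat x_+,x)]\le\frac{1}{\bar M-2L_f}\mathbb E[\mathrm{Var}_{\hat g}(\hat x_+)+\mathrm{Var}_{\hat g}(x)]+6\delta_f+2\,\mathbb E\{[\min\{\hat M_+,\bar M\}-M]_+\Omega\}.$$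
   Context: Space: $\mathbb R^d$ with standard inner product $\langle\cdot,\cdot\rangle$, norm $\|x\|=\langle Bx,x\rangle^{1/2}$ ($B$ a fixed positive definite matrix), dual norm $\|s\|_*=\max_{\|x\|=1}\langle s,x\rangle=\langle s,B^{-1}s\rangle^{1/2}$. $[t]_+=\max\{t,0\}$. $\psi:\mathbb R^d\to\mathbb R\cup\{+\infty\}$ is a proper closed convex function, $\operatorname{dom}\psi=\{x:\psi(x)<+\infty\}$. Approximate smoothness: $f$ is $(\delta_f,L_f)$-approximately smooth ($\delta_f,L_f\ge0$) with components $\bar f:\mathbb R^d\to\mathbb R$, $\bar g:\mathbb R^d\to\mathbb R^d$ if $\beta(x,y):=f(y)-\bar f(x)-\langle\bar g(x),y-x\rangle$ satisfies $0\le\beta(x,y)\le\frac{L_f}{2}\|x-y\|^2+\delta_f$ for all $x,y\in\mathbb R^d$. Stochastic oracle: $\hat g=(g,\xi)$ is a random variable $\xi$ with a mapping $g$; a query at $x$ generates an independent copy of $\xi$ and returns $g(x,\xi)$. It is unbiased for $\bar g$ if $\mathbb E_\xi[g(x,\xi)]=\bar g(x)$ for all $x$. $\mathrm{Var}_{\hat g}(x)=\mathbb E_\xi[\|g(x,\xi)-\bar g(x)\|_*^2]$. Requirement (R) on a stepsize update rule $M_+(\cdot)$, with (absolute) constants $c_1,\dots,c_4>0$: given the current stepsize coefficient $M\ge0$, a constant $\Omega>0$, the current point $x\in\operatorname{dom}\psi$ with the stochastic gradient $\hat g_x$ (the output of a query of $\hat g$ at $x$), and the next random point $\hat x_+\in\operatorname{dom}\psi$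 (possibly dependent on $\hat g_x$) with the stochastic gradient $\hat g_{x_+}$ (the output of a query of $\hat g$ at $\hat x_+$), the rule computes $\hat M_+=M_+(M,\Omega,x,\hat x_+,\hat g_x,\hat g_{x_+})$ such that $\hat M_+\ge M$ and, for any $\bar M>c_2L_f$, $$\mathbb E[\hat\Delta(\hat M_+)+(\hat M_+-M)\Omega+\beta(\hat x_+,x)]\le\frac{c_1}{\bar M-c_2L_f}\mathbb E[\mathrm{Var}_{\hat g}(\hat x_+)+\mathrm{Var}_{\hat g}(x)]+c_3\delta_f+c_4\mathbb E\{[\min\{\hat M_+,\bar M\}-M]_+\Omega\},$$ where $\hat\Delta(\hat M_+)=\beta(x,\hat x_+)+\langle\bar g(x)-\hat g_x,\hat x_+-x\rangle-\frac{\hat M_+}{2}\|\hat x_+-x\|^2$ and the expectation is taken with respect to the entire randomness. *)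

theory Defs
  imports "HOL-Probability.Probability"
begin

definition positive_definite :: "real^'n^'n \<Rightarrow> bool" where
  "positive_definite B \<longleftrightarrow> transpose B = B \<and> (\<forall>x. x \<noteq> 0 \<longrightarrow> (B *v x) \<bullet> x > 0)"

definition bnorm :: "real^'n^'n \<Rightarrow> real^'n \<Rightarrow> real" where
  "bnorm B x = sqrt ((B *v x) \<bullet> x)"

text \<open>The supremum is a maximum, see \<open>dual_norm_attained\<close> and \<open>dual_norm_eq\<close> below.\<close>

definition dual_norm :: "real^'n^'n \<Rightarrow> real^'n \<Rightarrow> real" where
  "dual_norm B s = Sup {s \<bullet> x | x. bnorm B x = 1}"

definition extended_epigraph :: "('a \<Rightarrow> ereal) \<Rightarrow> ('a \<times> real) set" where
  "extended_epigraph \<psi> = {(x, t). \<psi> x \<le> ereal t}"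

definition effective_domain :: "('a \<Rightarrow> ereal) \<Rightarrow> 'a set" where
  "effective_domain \<psi> = {x. \<psi> x < \<infinity>}"

definition proper_closed_convex :: "('a::euclidean_space \<Rightarrow> ereal) \<Rightarrow> bool" where
  "proper_closed_convex \<psi> \<longleftrightarrow>
     (\<forall>x. \<psi> x \<noteq> -\<infinity>) \<and> effective_domain \<psi> \<noteq> {} \<and>
     closed (extended_epigraph \<psi>) \<and> convex (extended_epigraph \<psi>)"

definition approx_error ::
  "('a::real_inner \<Rightarrow> real) \<Rightarrow> ('a \<Rightarrow> real) \<Rightarrow> ('a \<Rightarrow> 'a) \<Rightarrow> 'a \<Rightarrow> 'a \<Rightarrow> real" where
  "approx_error f fbar gbar x y = f y - fbar x - gbar x \<bullet> (y - x)"

definition approx_smooth ::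
  "real^'n^'n \<Rightarrow> real \<Rightarrow> real \<Rightarrow> (real^'n \<Rightarrow> real) \<Rightarrow> (real^'n \<Rightarrow> real) \<Rightarrow> (real^'n \<Rightarrow> real^'n) \<Rightarrow> bool"
  where
  "approx_smooth B \<delta> L f fbar gbar \<longleftrightarrow> \<delta> \<ge> 0 \<and> L \<ge> 0 \<and>
     (\<forall>x y. 0 \<le> approx_error f fbar gbar x y \<and>
            approx_error f fbar gbar x y \<le> L / 2 * (bnorm B (x - y))\<^sup>2 + \<delta>)"

text \<open>
  An oracle is given by the law \<open>D\<close> of the random variable \<open>\<xi>\<close> and the mapping \<open>g\<close>. Joint
  measurability makes the answer to a query at a random point a random vector.
\<close>

definition stochastic_oracle :: "'s measure \<Rightarrow> (real^'n \<Rightarrow> 's \<Rightarrow> real^'n) \<Rightarrow> bool" where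
  "stochastic_oracle D g \<longleftrightarrow> prob_space D \<and> (\<lambda>(x, \<xi>). g x \<xi>) \<in> borel_measurable (borel \<Otimes>\<^sub>M D)"

definition unbiased_oracle ::
  "'s measure \<Rightarrow> (real^'n \<Rightarrow> 's \<Rightarrow> real^'n) \<Rightarrow> (real^'n \<Rightarrow> real^'n) \<Rightarrow> bool" where
  "unbiased_oracle D g gbar \<longleftrightarrow>
     (\<forall>x. integrable D (g x) \<and> (\<integral>\<xi>. g x \<xi> \<partial>D) = gbar x)"

text \<open>The variance may be infinite, hence its type.\<close>

definition oracle_variance ::
  "real^'n^'n \<Rightarrow> 's measure \<Rightarrow> (real^'n \<Rightarrow> 's \<Rightarrow> real^'n) \<Rightarrow> (real^'n \<Rightarrow> real^'n) \<Rightarrow> real^'n \<Rightarrow> ennreal"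
  where
  "oracle_variance B D g gbar x = (\<integral>\<^sup>+\<xi>. ennreal ((dual_norm B (g x \<xi> - gbar x))\<^sup>2) \<partial>D)"

text \<open>
  Expectation with values in the extended reals. Unlike the Bochner integral, which is \<open>0\<close> for
  every non-integrable function, it takes the values \<open>\<infinity>\<close> and \<open>-\<infinity>\<close>; it is undefined
  (and not to be used) only when the positive and the negative part both have infinite integral.
\<close>

definition has_expectation :: "'w measure \<Rightarrow> ('w \<Rightarrow> real) \<Rightarrow> bool" where
  "has_expectation P X \<longleftrightarrow> X \<in> borel_measurable P \<and>
     ((\<integral>\<^sup>+\<omega>. ennreal (X \<omega>) \<partial>P) < \<infinity> \<or> (\<integral>\<^sup>+\<omega>. ennreal (- X \<omega>) \<partial>P) < \<infinity>)"

definition extended_expectation :: "'w measure \<Rightarrow> ('w \<Rightarrow> real) \<Rightarrow> ereal" where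
  "extended_expectation P X =
     enn2ereal (\<integral>\<^sup>+\<omega>. ennreal (X \<omega>) \<partial>P) - enn2ereal (\<integral>\<^sup>+\<omega>. ennreal (- X \<omega>) \<partial>P)"

text \<open>The library's \<open>indep_var\<close>, but for random variables with values in different types.\<close>

definition indep_random_variables ::
  "'w measure \<Rightarrow> 'a measure \<Rightarrow> ('w \<Rightarrow> 'a) \<Rightarrow> 'b measure \<Rightarrow> ('w \<Rightarrow> 'b) \<Rightarrow> bool" where
  "indep_random_variables P S X T Y \<longleftrightarrow> X \<in> measurable P S \<and> Y \<in> measurable P T \<and>
     prob_space.indep_set P {X -` A \<inter> space P | A. A \<in> sets S} {Y -` A \<inter> space P | A. A \<in> sets T}"

text \<open>
  The arguments of a stepsize update rule are, in this order, the current coefficient \<open>M\<close>, the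
  constant \<open>\<Omega>\<close>, the current and the next point, and the stochastic gradients at these two points.
\<close>

type_synonym 'v stepsize_rule = "real \<Rightarrow> real \<Rightarrow> 'v \<Rightarrow> 'v \<Rightarrow> 'v \<Rightarrow> 'v \<Rightarrow> real"

text \<open>
  The current data \<open>M\<close>, \<open>\<Omega>\<close>, \<open>x\<close> are deterministic. The query at \<open>x\<close> uses the copy \<open>\<xi>\<^sub>1\<close> of
  \<open>\<xi>\<close>; the next point \<open>X\<close> is any random point, so it may depend on \<open>\<xi>\<^sub>1\<close>; the query at \<open>X\<close> uses
  a copy \<open>\<xi>\<^sub>2\<close> that is independent of \<open>(\<xi>\<^sub>1, X)\<close>.

  The expectation on the left-hand side of the inequality need not exist without moment
  conditions on \<open>X\<close>, and \<open>fbar\<close> is an arbitrary function. So the inequality is required only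
  when that expectation exists. The quantities on the right-hand side are nonnegative.
\<close>

definition stepsize_requirement ::
  "'w measure \<Rightarrow> real^'n^'n \<Rightarrow> (real^'n \<Rightarrow> ereal) \<Rightarrow> real \<Rightarrow> real \<Rightarrow> (real^'n \<Rightarrow> real) \<Rightarrow> (real^'n \<Rightarrow> real) \<Rightarrow>
   (real^'n \<Rightarrow> real^'n) \<Rightarrow> 's measure \<Rightarrow> (real^'n \<Rightarrow> 's \<Rightarrow> real^'n) \<Rightarrow> (real^'n) stepsize_rule \<Rightarrow>
   real \<Rightarrow> real \<Rightarrow> real \<Rightarrow> real \<Rightarrow> bool" where
  "stepsize_requirement P B \<psi> \<delta> L f fbar gbar D g rule c\<^sub>1 c\<^sub>2 c\<^sub>3 c\<^sub>4 \<longleftrightarrow>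
     c\<^sub>1 > 0 \<and> c\<^sub>2 > 0 \<and> c\<^sub>3 > 0 \<and> c\<^sub>4 > 0 \<and>
     (\<forall>M \<Omega> x \<xi>\<^sub>1 X \<xi>\<^sub>2.
        M \<ge> 0 \<and> \<Omega> > 0 \<and> x \<in> effective_domain \<psi> \<and>
        \<xi>\<^sub>1 \<in> measurable P D \<and> distr P D \<xi>\<^sub>1 = D \<and>
        X \<in> borel_measurable P \<and> (AE \<omega> in P. X \<omega> \<in> effective_domain \<psi>) \<and>
        \<xi>\<^sub>2 \<in> measurable P D \<and> distr P D \<xi>\<^sub>2 = D \<and>
        indep_random_variables P (D \<Otimes>\<^sub>M borel) (\<lambda>\<omega>. (\<xi>\<^sub>1 \<omega>, X \<omega>)) D \<xi>\<^sub>2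
        \<longrightarrow>
        (let gx = (\<lambda>\<omega>. g x (\<xi>\<^sub>1 \<omega>));
             gX = (\<lambda>\<omega>. g (X \<omega>) (\<xi>\<^sub>2 \<omega>));
             M' = (\<lambda>\<omega>. rule M \<Omega> x (X \<omega>) (gx \<omega>) (gX \<omega>));
             \<beta> = approx_error f fbar gbar;
             \<Delta> = (\<lambda>\<omega>. \<beta> x (X \<omega>) + (gbar x - gx \<omega>) \<bullet> (X \<omega> - x)
                       - M' \<omega> / 2 * (bnorm B (X \<omega> - x))\<^sup>2);
             lhs = (\<lambda>\<omega>. \<Delta> \<omega> + (M' \<omega> - M) * \<Omega> + \<beta> (X \<omega>) x);
             Var = oracle_variance B D g gbar
         in M' \<in> borel_measurable P \<and>
            (\<forall>\<omega>\<in>space P. M' \<omega> \<ge> M) \<and>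
            (has_expectation P lhs \<longrightarrow>
              (\<forall>Mbar. Mbar > c\<^sub>2 * L \<longrightarrow>
                extended_expectation P lhs
                  \<le> ereal (c\<^sub>1 / (Mbar - c\<^sub>2 * L)) * enn2ereal (\<integral>\<^sup>+\<omega>. Var (X \<omega>) + Var x \<partial>P)
                    + ereal (c\<^sub>3 * \<delta>)
                    + ereal c\<^sub>4 * extended_expectation P
                        (\<lambda>\<omega>. max (min (M' \<omega>) Mbar - M) 0 * \<Omega>)))))"

text \<open>The equation has exactly one solution, see \<open>stepsize_equation_unique_solution\<close> below.\<close>

definition stepsize_equation ::
  "real^'n^'n \<Rightarrow> real \<Rightarrow> real \<Rightarrow> real^'n \<Rightarrow> real^'n \<Rightarrow> real^'n \<Rightarrow> real^'n \<Rightarrow> real \<Rightarrow> bool" where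
  "stepsize_equation B M \<Omega> x x' gx gx' m \<longleftrightarrow>
     (m - M) * \<Omega> = max ((gx' - gx) \<bullet> (x' - x) - m / 2 * (bnorm B (x' - x))\<^sup>2) 0"

definition stepsize_update :: "real^'n^'n \<Rightarrow> (real^'n) stepsize_rule" where
  "stepsize_update B M \<Omega> x x' gx gx' = (THE m. stepsize_equation B M \<Omega> x x' gx gx' m)"

lemma stepsize_equation_unique_solution:
  assumes "\<Omega> > 0"
  shows "\<exists>!m. stepsize_equation B M \<Omega> x x' gx gx' m"
proof -
  define a where "a = (gx' - gx) \<bullet> (x' - x)"
  define r where "r = (bnorm B (x' - x))\<^sup>2"
  have r: "r \<ge> 0" by (simp add: r_def)
  define c where "c = max (a - M / 2 * r) 0"
  have p: "\<Omega> + r / 2 > 0" using r assms by simp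
  define t where "t = c / (\<Omega> + r / 2)"
  have c: "t * \<Omega> + t * r / 2 = c"
  proof -
    have "t * (\<Omega> + r / 2) = c" using p by (simp add: t_def)
    then show ?thesis by (simp add: algebra_simps)
  qed
  have t: "t \<ge> 0" using p by (simp add: t_def c_def)
  have ex: "(M + t - M) * \<Omega> = max (a - (M + t) / 2 * r) 0"
  proof (cases "a - M / 2 * r > 0")
    case True
    have "t * \<Omega> \<ge> 0" using t assms by simp
    moreover have "a - (M + t) / 2 * r = t * \<Omega>"
      using c True by (simp add: c_def field_simps)
    ultimately show ?thesis by simp
  next
    case False
    then have "t = 0" by (simp add: t_def c_def)
    then show ?thesis using False by simp
  qed
  have uniq: "\<not> m < m'"
    if m: "(m - M) * \<Omega> = max (a - m / 2 * r) 0" and m': "(m' - M) * \<Omega> = max (a - m' / 2 * r) 0"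
    for m m'
  proof
    assume "m < m'"
    then have "m * \<Omega> < m' * \<Omega>" "m * r \<le> m' * r"
      using assms r by (simp_all add: mult_right_mono)
    then show False using m m' by (simp add: algebra_simps max_def split: if_splits)
  qed
  show ?thesis
    unfolding stepsize_equation_def a_def[symmetric] r_def[symmetric]
    using ex uniq by (metis linorder_neqE_linordered_idom)
qed

lemma positive_definite_nonneg:
  assumes "positive_definite B"
  shows "(B *v x) \<bullet> x \<ge> 0"
  using assms by (cases "x = 0") (auto simp: positive_definite_def less_imp_le)

lemma positive_definite_inner_commute:
  assumes "positive_definite B"
  shows "(B *v x) \<bullet> y = (B *v y) \<bullet> x"
proof -
  have "(B *v x) \<bullet> y = (x v* B) \<bullet> y"
    using assms by (metis positive_definite_def transpose_matrix_vector)
  also have "\<dots> = (B *v y) \<bullet> x"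
    by (metis dot_lmul_matrix inner_commute)
  finally show ?thesis .
qed

lemma positive_definite_invertible:
  fixes B :: "real^'n^'n"
  assumes "positive_definite B"
  shows "invertible B"
proof -
  have "x = 0" if "B *v x = 0" for x
    using assms that by (force simp: positive_definite_def)
  then show ?thesis
    by (simp add: invertible_left_inverse matrix_left_invertible_ker)
qed

lemma
  fixes B :: "real^'n^'n"
  assumes B: "positive_definite B"
  shows dual_norm_eq: "dual_norm B s = sqrt (s \<bullet> (matrix_inv B *v s))"
    and dual_norm_attained: "\<exists>x. bnorm B x = 1 \<and> s \<bullet> x = dual_norm B s"
    and dual_norm_upper: "bnorm B x = 1 \<Longrightarrow> s \<bullet> x \<le> dual_norm B s"
proof -
  define u where "u = matrix_inv B *v s"
  define q where "q = s \<bullet> u"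
  have "B ** matrix_inv B = mat 1 \<and> matrix_inv B ** B = mat 1"
    using positive_definite_invertible[OF B]
    unfolding invertible_def matrix_inv_def by (rule someI_ex)
  then have Bu: "B *v u = s"
    by (simp add: u_def matrix_vector_mul_assoc)
  have q0: "q \<ge> 0"
    using positive_definite_nonneg[OF B, of u] by (simp add: q_def Bu)
  have le: "s \<bullet> x \<le> sqrt q" if "bnorm B x = 1" for x
  proof -
    define t where "t = s \<bullet> x"
    have x1: "(B *v x) \<bullet> x = 1" using that by (simp add: bnorm_def)
    have "0 \<le> (B *v (u - t *\<^sub>R x)) \<bullet> (u - t *\<^sub>R x)"
      by (rule positive_definite_nonneg[OF B])
    also have "\<dots> = q - t * t - t * ((B *v x) \<bullet> u) + t * t * ((B *v x) \<bullet> x)"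
      by (simp add: matrix_vector_mult_diff_distrib matrix_vector_mult_scaleR Bu inner_diff_left
          inner_diff_right q_def t_def algebra_simps)
    also have "\<dots> = q - t\<^sup>2"
      using positive_definite_inner_commute[OF B, of x u]
      by (simp add: Bu x1 t_def power2_eq_square)
    finally show ?thesis by (simp add: t_def real_le_rsqrt)
  qed
  have ex: "\<exists>x. bnorm B x = 1 \<and> s \<bullet> x = sqrt q"
  proof -
    have norm1: "bnorm B ((1 / sqrt ((B *v v) \<bullet> v)) *\<^sub>R v) = 1" if "v \<noteq> 0" for v
    proof -
      have "(B *v v) \<bullet> v > 0" using B that by (simp add: positive_definite_def)
      then show ?thesis by (simp add: bnorm_def matrix_vector_mult_scaleR)
    qed
    show ?thesis
    proof (cases "u = 0")
      case True
      then have "s = 0" using Bu by auto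
      moreover obtain v :: "real^'n" where "v \<noteq> 0"
        using zero_neq_one by blast
      ultimately show ?thesis using norm1 by (auto simp: q_def)
    next
      case False
      have "s \<bullet> ((1 / sqrt q) *\<^sub>R u) = q / sqrt q" by (simp add: q_def)
      then have "s \<bullet> ((1 / sqrt q) *\<^sub>R u) = sqrt q" using q0 by (simp add: real_div_sqrt)
      then show ?thesis using norm1[OF False] by (auto simp: Bu q_def)
    qed
  qed
  have "dual_norm B s = sqrt q"
    unfolding dual_norm_def
  proof (rule cSup_eq_maximum)
    show "sqrt q \<in> {s \<bullet> x |x. bnorm B x = 1}" using ex by force
  qed (use le in auto)
  then show "dual_norm B s = sqrt (s \<bullet> (matrix_inv B *v s))"
    "\<exists>x. bnorm B x = 1 \<and> s \<bullet> x = dual_norm B s"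
    "bnorm B x = 1 \<Longrightarrow> s \<bullet> x \<le> dual_norm B s"
    using ex le by (simp_all add: q_def u_def)
qed

end

theory Submission
  imports Defs
begin

text \<open>
  Let \<open>\<sigma>\<close> denote the oracle errors, \<open>s = X - x\<close>, and \<open>r\<close> the norm of \<open>s\<close>. Since
  \<open>\<beta> x X + \<beta> X x\<close> and \<open>(gbar X - gbar x) \<bullet> s\<close> differ by at most \<open>2 * \<delta>\<close>, the left-hand side is at most
  \<open>2 * \<delta> - \<sigma>\<^sub>X \<bullet> s\<close> plus twice the positive part of \<open>\<Delta>\<^sub>1\<close>. That positive part equals
  \<open>(M' - M) * \<Omega>\<close>, which suffices if \<open>M' \<le> Mbar\<close>. Otherwise \<open>2 * \<Delta>\<^sub>1\<close> is at most
  \<open>2 * (\<sigma>\<^sub>X - \<sigma>\<^sub>x) \<bullet> s - (Mbar - 2 * L) * r\<^sup>2 + 4 * \<delta>\<close>, and Fenchel--Young bounds this by the squared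
  dual norm of \<open>\<sigma>\<^sub>X - \<sigma>\<^sub>x\<close>. The case distinction depends on \<open>\<sigma>\<^sub>X\<close>, so both bounds are added before
  taking expectations; every remaining term linear in \<open>\<sigma>\<^sub>X\<close> is then centered given \<open>(\<xi>\<^sub>1, X)\<close>.
  As these terms need not be integrable, they are removed by truncation.
\<close>

section \<open>Joint laws of independent variables and centered terms\<close>

text \<open>Both laws agree on measurable rectangles, where independence factors the probability;
  since the factors are \<sigma>-finite, rectangles determine the product measure.\<close>

lemma indep_random_variables_distr_Pair:
  assumes P: "prob_space P" and ind: "indep_random_variables P S X T Y"
  shows "distr P (S \<Otimes>\<^sub>M T) (\<lambda>\<omega>. (X \<omega>, Y \<omega>)) = distr P S X \<Otimes>\<^sub>M distr P T Y"
proof -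
  interpret prob_space P by (rule P)
  have X[measurable]: "X \<in> measurable P S" and Y[measurable]: "Y \<in> measurable P T"
    using ind by (auto simp: indep_random_variables_def)
  interpret PX: prob_space "distr P S X" by (rule prob_space_distr) fact
  interpret PY: prob_space "distr P T Y" by (rule prob_space_distr) fact
  show ?thesis
  proof (rule pair_measure_eqI[symmetric])
    fix A C assume "A \<in> sets (distr P S X)" "C \<in> sets (distr P T Y)"
    then have A[measurable]: "A \<in> sets S" and C[measurable]: "C \<in> sets T" by auto
    have "prob ((X -` A \<inter> space P) \<inter> (Y -` C \<inter> space P))
        = prob (X -` A \<inter> space P) * prob (Y -` C \<inter> space P)"
      using ind A C by (intro indep_setD) (auto simp: indep_random_variables_def)
    moreover have "(\<lambda>\<omega>. (X \<omega>, Y \<omega>)) -` (A \<times> C) \<inter> space P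
        = (X -` A \<inter> space P) \<inter> (Y -` C \<inter> space P)" by auto
    ultimately show "emeasure (distr P S X) A * emeasure (distr P T Y) C
        = emeasure (distr P (S \<Otimes>\<^sub>M T) (\<lambda>\<omega>. (X \<omega>, Y \<omega>))) (A \<times> C)"
      by (simp add: emeasure_distr emeasure_eq_measure ennreal_mult)
  qed (auto intro: PX.sigma_finite_measure_axioms PY.sigma_finite_measure_axioms)
qed

text \<open>Tonelli for the joint law. The inner integral acts as the conditional expectation given
  \<open>X\<close>, so a query at a random point can be averaged with that point held fixed.\<close>

lemma nn_integral_indep_random_variables:
  assumes P: "prob_space P" and ind: "indep_random_variables P S X T Y"
    and h: "case_prod h \<in> borel_measurable (S \<Otimes>\<^sub>M T)"
  shows "(\<integral>\<^sup>+\<omega>. h (X \<omega>) (Y \<omega>) \<partial>P) = (\<integral>\<^sup>+\<omega>. (\<integral>\<^sup>+y. h (X \<omega>) y \<partial>distr P T Y) \<partial>P)"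
proof -
  interpret prob_space P by (rule P)
  have X[measurable]: "X \<in> measurable P S" and Y[measurable]: "Y \<in> measurable P T"
    using ind by (auto simp: indep_random_variables_def)
  interpret PY: prob_space "distr P T Y" by (rule prob_space_distr) fact
  note h[measurable]
  have "(\<integral>\<^sup>+\<omega>. h (X \<omega>) (Y \<omega>) \<partial>P) = (\<integral>\<^sup>+p. case_prod h p \<partial>distr P (S \<Otimes>\<^sub>M T) (\<lambda>\<omega>. (X \<omega>, Y \<omega>)))"
    by (simp add: nn_integral_distr)
  also have "\<dots> = (\<integral>\<^sup>+x. (\<integral>\<^sup>+y. h x y \<partial>distr P T Y) \<partial>distr P S X)"
    unfolding indep_random_variables_distr_Pair[OF P ind]
    by (subst PY.nn_integral_fst[symmetric]) (use h in \<open>simp_all cong: measurable_cong_sets\<close>)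
  also have "\<dots> = (\<integral>\<^sup>+\<omega>. (\<integral>\<^sup>+y. h (X \<omega>) y \<partial>distr P T Y) \<partial>P)"
    by (rule nn_integral_distr) measurable
  finally show ?thesis .
qed

text \<open>
  The term \<open>k (X \<omega>) (Y \<omega>)\<close> is centered given \<open>X\<close> but need not be integrable. It is integrable with
  integral \<open>0\<close> on the events where the conditional expectation of its absolute value is at most \<open>n\<close>.
\<close>

lemma nn_integral_le_add_centered:
  fixes k :: "'a \<Rightarrow> 'b \<Rightarrow> real" and u z :: "'w \<Rightarrow> real"
  assumes P: "prob_space P" and ind: "indep_random_variables P S X T Y"
    and k: "case_prod k \<in> borel_measurable (S \<Otimes>\<^sub>M T)"
    and int: "\<And>x. x \<in> space S \<Longrightarrow> integrable (distr P T Y) (k x)"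
    and zero: "\<And>x. x \<in> space S \<Longrightarrow> (\<integral>y. k x y \<partial>distr P T Y) = 0"
    and u: "u \<in> borel_measurable P" and z: "z \<in> borel_measurable P"
    and le: "\<And>\<omega>. \<omega> \<in> space P \<Longrightarrow> u \<omega> + k (X \<omega>) (Y \<omega>) \<le> z \<omega>"
    and z0: "\<And>\<omega>. \<omega> \<in> space P \<Longrightarrow> 0 \<le> z \<omega>"
  shows "(\<integral>\<^sup>+\<omega>. ennreal (u \<omega>) \<partial>P) \<le> (\<integral>\<^sup>+\<omega>. ennreal (z \<omega>) \<partial>P) + (\<integral>\<^sup>+\<omega>. ennreal (- u \<omega>) \<partial>P)"
proof -
  interpret prob_space P by (rule P)
  have X[measurable]: "X \<in> measurable P S" and Y[measurable]: "Y \<in> measurable P T"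
    using ind by (auto simp: indep_random_variables_def)
  note k[measurable] u[measurable] z[measurable]
  define Q where "Q = distr P T Y"
  interpret Q: prob_space Q unfolding Q_def by (rule prob_space_distr) fact
  have sQ[measurable_cong]: "sets Q = sets T" by (simp add: Q_def)
  define N where "N x = (\<integral>\<^sup>+y. ennreal \<bar>k x y\<bar> \<partial>Q)" for x
  have N[measurable]: "N \<in> borel_measurable S" unfolding N_def by measurable
  have Nfin: "N x < \<infinity>" if "x \<in> space S" for x
    using int[OF that] unfolding N_def Q_def by (simp add: integrable_iff_bounded)
  define A where "A n = {\<omega>\<in>space P. N (X \<omega>) \<le> of_nat n}" for n :: nat
  have A[measurable]: "A n \<in> sets P" for n unfolding A_def by measurable
  have kpm: "(\<integral>\<^sup>+y. ennreal (k x y) \<partial>Q) = (\<integral>\<^sup>+y. ennreal (- k x y) \<partial>Q)"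
    "(\<integral>\<^sup>+y. ennreal (k x y) \<partial>Q) \<le> N x" if x: "x \<in> space S" for x
  proof -
    have i: "integrable Q (k x)" using int[OF x] by (simp add: Q_def)
    let ?p = "\<integral>\<^sup>+y. ennreal (k x y) \<partial>Q" and ?m = "\<integral>\<^sup>+y. ennreal (- k x y) \<partial>Q"
    have "?p \<le> N x" unfolding N_def by (intro nn_integral_mono ennreal_leI) simp
    moreover have "?m \<le> N x" unfolding N_def by (intro nn_integral_mono ennreal_leI) simp
    moreover have "enn2real ?p - enn2real ?m = 0"
      using real_lebesgue_integral_def[OF i] zero[OF x] by (simp add: Q_def)
    ultimately show "?p = ?m" "?p \<le> N x"
      using Nfin[OF x] by (cases ?p; cases ?m; auto simp: top_unique)+
  qed
  have trunc: "(\<integral>\<^sup>+\<omega>. ennreal (u \<omega>) * indicator (A n) \<omega> \<partial>P)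
      \<le> (\<integral>\<^sup>+\<omega>. ennreal (z \<omega>) \<partial>P) + (\<integral>\<^sup>+\<omega>. ennreal (- u \<omega>) \<partial>P)" for n
  proof -
    \<comment> \<open>The truncation event depends on \<open>X\<close> alone, so its indicator
      leaves the inner integral over \<open>Y\<close> and does not disturb the centering.\<close>
    define a where "a x = (indicator {x\<in>space S. N x \<le> of_nat n} x :: ennreal)" for x
    have a[measurable]: "a \<in> borel_measurable S" unfolding a_def by measurable
    have aX: "indicator (A n) \<omega> = a (X \<omega>)" if "\<omega> \<in> space P" for \<omega>
      using that measurable_space[OF X that] by (auto simp: A_def a_def indicator_def)
    let ?K = "\<integral>\<^sup>+\<omega>. ennreal (k (X \<omega>) (Y \<omega>)) * a (X \<omega>) \<partial>P"
    let ?K' = "\<integral>\<^sup>+\<omega>. ennreal (- k (X \<omega>) (Y \<omega>)) * a (X \<omega>) \<partial>P"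
    have K: "?K = (\<integral>\<^sup>+\<omega>. (\<integral>\<^sup>+y. ennreal (k (X \<omega>) y) \<partial>Q) * a (X \<omega>) \<partial>P)"
      unfolding Q_def
      by (subst nn_integral_indep_random_variables[OF P ind,
          of "\<lambda>x y. ennreal (k x y) * a x"])
        (simp_all add: nn_integral_multc cong: nn_integral_cong)
    have K': "?K' = (\<integral>\<^sup>+\<omega>. (\<integral>\<^sup>+y. ennreal (- k (X \<omega>) y) \<partial>Q) * a (X \<omega>) \<partial>P)"
      unfolding Q_def
      by (subst nn_integral_indep_random_variables[OF P ind,
          of "\<lambda>x y. ennreal (- k x y) * a x"])
        (simp_all add: nn_integral_multc cong: nn_integral_cong)
    have KK': "?K' = ?K"
      unfolding K K' by (intro nn_integral_cong) (simp add: kpm(1) measurable_space[OF X])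
    have "?K \<le> (\<integral>\<^sup>+\<omega>. of_nat n \<partial>P)"
      unfolding K
    proof (rule nn_integral_mono)
      fix \<omega> assume "\<omega> \<in> space P"
      then have "X \<omega> \<in> space S" by (rule measurable_space[OF X])
      from kpm(2)[OF this] show "(\<integral>\<^sup>+y. ennreal (k (X \<omega>) y) \<partial>Q) * a (X \<omega>) \<le> of_nat n"
        by (auto simp: a_def indicator_def)
    qed
    \<comment> \<open>This finiteness is what permits cancelling \<open>?K\<close> from both sides
      below.\<close>
    then have Kfin: "?K \<noteq> \<top>"
      by (auto simp: emeasure_space_1 top_unique)
    have "(\<integral>\<^sup>+\<omega>. ennreal (u \<omega>) * a (X \<omega>) \<partial>P) + ?K
        = (\<integral>\<^sup>+\<omega>. ennreal (u \<omega>) * a (X \<omega>) + ennreal (k (X \<omega>) (Y \<omega>)) * a (X \<omega>) \<partial>P)"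
      by (rule nn_integral_add[symmetric]) measurable
    also have "\<dots> \<le> (\<integral>\<^sup>+\<omega>. (ennreal (z \<omega>) + ennreal (- u \<omega>))
        + ennreal (- k (X \<omega>) (Y \<omega>)) * a (X \<omega>) \<partial>P)"
    proof (rule nn_integral_mono)
      fix \<omega> assume w: "\<omega> \<in> space P"
      have pos: "ennreal t = ennreal (max t 0)" for t by (simp add: max_def ennreal_neg)
      \<comment> \<open>The inequality \<open>le\<close> is regrouped into positive and negative
        parts, so that both sides become sums of nonnegative terms.\<close>
      have "max (u \<omega>) 0 + max (k (X \<omega>) (Y \<omega>)) 0
          \<le> z \<omega> + max (- u \<omega>) 0 + max (- k (X \<omega>) (Y \<omega>)) 0"
        using le[OF w] by (simp add: max_def)
      then have "ennreal (max (u \<omega>) 0 + max (k (X \<omega>) (Y \<omega>)) 0)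
          \<le> ennreal (z \<omega> + max (- u \<omega>) 0 + max (- k (X \<omega>) (Y \<omega>)) 0)"
        by (rule ennreal_leI)
      then have "ennreal (u \<omega>) + ennreal (k (X \<omega>) (Y \<omega>))
          \<le> ennreal (z \<omega>) + ennreal (- u \<omega>) + ennreal (- k (X \<omega>) (Y \<omega>))"
        using z0[OF w] by (simp add: ennreal_plus pos[symmetric])
      then show "ennreal (u \<omega>) * a (X \<omega>) + ennreal (k (X \<omega>) (Y \<omega>)) * a (X \<omega>)
          \<le> (ennreal (z \<omega>) + ennreal (- u \<omega>)) + ennreal (- k (X \<omega>) (Y \<omega>)) * a (X \<omega>)"
        by (auto simp: a_def indicator_def)
    qed
    also have "\<dots> = ((\<integral>\<^sup>+\<omega>. ennreal (z \<omega>) \<partial>P) + (\<integral>\<^sup>+\<omega>. ennreal (- u \<omega>) \<partial>P)) + ?K'"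
      by (subst nn_integral_add, measurable, subst nn_integral_add, measurable)
    finally have "(\<integral>\<^sup>+\<omega>. ennreal (u \<omega>) * a (X \<omega>) \<partial>P)
        \<le> (\<integral>\<^sup>+\<omega>. ennreal (z \<omega>) \<partial>P) + (\<integral>\<^sup>+\<omega>. ennreal (- u \<omega>) \<partial>P)"
      unfolding KK' using Kfin by (simp add: ennreal_add_left_cancel_le add.commute[of _ ?K])
    then show ?thesis by (simp add: aX cong: nn_integral_cong)
  qed
  \<comment> \<open>\<open>N\<close> is finite on \<open>space S\<close>, so the events
    \<open>A n\<close> exhaust the space and monotone convergence removes the truncation.\<close>
  have "(\<integral>\<^sup>+\<omega>. ennreal (u \<omega>) \<partial>P)
      = (\<integral>\<^sup>+\<omega>. (SUP n. ennreal (u \<omega>) * indicator (A n) \<omega>) \<partial>P)"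
  proof (rule nn_integral_cong)
    fix \<omega> assume w: "\<omega> \<in> space P"
    obtain n :: nat where "N (X \<omega>) < of_nat n"
      using ennreal_Ex_less_of_nat[OF Nfin[OF measurable_space[OF X w], unfolded infinity_ennreal_def]]
      by blast
    then have "\<omega> \<in> A n" using w by (simp add: A_def)
    then have "ennreal (u \<omega>) \<le> ennreal (u \<omega>) * indicator (A n) \<omega>" by simp
    also have "\<dots> \<le> (SUP n. ennreal (u \<omega>) * indicator (A n) \<omega>)" by (rule SUP_upper) simp
    finally show "ennreal (u \<omega>) = (SUP n. ennreal (u \<omega>) * indicator (A n) \<omega>)"
      by (intro antisym SUP_least) (auto simp: indicator_def)
  qed
  also have "\<dots> = (SUP n. \<integral>\<^sup>+\<omega>. ennreal (u \<omega>) * indicator (A n) \<omega> \<partial>P)"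
  proof (rule nn_integral_monotone_convergence_SUP)
    have "A m \<subseteq> A n" if "m \<le> n" for m n
    proof -
      have "(of_nat m :: ennreal) \<le> of_nat n" using that by (rule of_nat_mono)
      then show ?thesis unfolding A_def by (blast intro: order_trans)
    qed
    then show "incseq (\<lambda>n \<omega>. ennreal (u \<omega>) * indicator (A n) \<omega>)"
      by (intro monoI le_funI mult_left_mono indicator_leI) auto
  qed measurable
  also have "\<dots> \<le> (\<integral>\<^sup>+\<omega>. ennreal (z \<omega>) \<partial>P) + (\<integral>\<^sup>+\<omega>. ennreal (- u \<omega>) \<partial>P)"
    by (rule SUP_least) (rule trunc)
  finally show ?thesis .
qed

section \<open>Expectations in the extended reals\<close>

text \<open>If the negative part has finite integral, it can be subtracted from both sides.
  Otherwise \<open>has_expectation\<close> makes the positive part finite, and the expectation is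
  \<open>-\<infinity>\<close>.\<close>

lemma extended_expectation_leI:
  assumes "has_expectation P u"
    and le: "(\<integral>\<^sup>+\<omega>. ennreal (u \<omega>) \<partial>P) \<le> C + (\<integral>\<^sup>+\<omega>. ennreal (- u \<omega>) \<partial>P)"
  shows "extended_expectation P u \<le> enn2ereal C"
proof -
  let ?p = "\<integral>\<^sup>+\<omega>. ennreal (u \<omega>) \<partial>P" and ?m = "\<integral>\<^sup>+\<omega>. ennreal (- u \<omega>) \<partial>P"
  have le': "enn2ereal ?p \<le> enn2ereal C + enn2ereal ?m"
    using le by (simp add: less_eq_ennreal.rep_eq plus_ennreal.rep_eq)
  show ?thesis
  proof (cases "?m = \<top>")
    case True
    then have "?p < \<top>" using assms(1) by (auto simp: has_expectation_def)
    then have "enn2ereal ?p \<noteq> \<infinity>" by (simp add: enn2ereal_eq_top_iff)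
    then show ?thesis
      by (cases "enn2ereal ?p") (auto simp: extended_expectation_def True)
  next
    case False
    then obtain m where m: "?m = ennreal m" "m \<ge> 0" by (cases ?m) auto
    then show ?thesis
      using le' by (simp add: extended_expectation_def ereal_minus_le)
  qed
qed

lemma extended_expectation_nonneg:
  assumes "\<And>\<omega>. \<omega> \<in> space P \<Longrightarrow> 0 \<le> u \<omega>"
  shows "extended_expectation P u = enn2ereal (\<integral>\<^sup>+\<omega>. ennreal (u \<omega>) \<partial>P)"
proof -
  have "(\<integral>\<^sup>+\<omega>. ennreal (- u \<omega>) \<partial>P) = (\<integral>\<^sup>+\<omega>. 0 \<partial>P)"
    using assms by (intro nn_integral_cong) (simp add: ennreal_neg)
  then show ?thesis by (simp add: extended_expectation_def zero_ennreal.rep_eq)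
qed

section \<open>The norm of \<open>B\<close> and its dual as quadratic forms\<close>

lemma bnorm_power2:
  assumes "positive_definite B"
  shows "(bnorm B x)\<^sup>2 = (B *v x) \<bullet> x"
  using positive_definite_nonneg[OF assms] by (simp add: bnorm_def)

lemma bnorm_minus_commute:
  "bnorm B (x - y) = bnorm B (y - x)"
proof -
  have "B *v (x - y) = - (B *v (y - x))"
    by (simp add: matrix_vector_mult_diff_distrib)
  then have "(B *v (x - y)) \<bullet> (x - y) = (B *v (y - x)) \<bullet> (y - x)"
    by (simp add: inner_diff_right)
  then show ?thesis by (simp add: bnorm_def)
qed

lemma positive_definite_mult_inv:
  fixes B :: "real^'n^'n"
  assumes "positive_definite B"
  shows "B *v (matrix_inv B *v s) = s"
proof -
  have "B ** matrix_inv B = mat 1 \<and> matrix_inv B ** B = mat 1"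
    using positive_definite_invertible[OF assms]
    unfolding invertible_def matrix_inv_def by (rule someI_ex)
  then show ?thesis by (simp add: matrix_vector_mul_assoc)
qed

text \<open>Replaces the supremum by a quadratic form, which can be expanded and is visibly
  measurable in \<open>s\<close>.\<close>

lemma dual_norm_power2:
  fixes B :: "real^'n^'n"
  assumes "positive_definite B"
  shows "(dual_norm B s)\<^sup>2 = s \<bullet> (matrix_inv B *v s)"
  using positive_definite_nonneg[OF assms, of "matrix_inv B *v s"]
  by (simp add: dual_norm_eq[OF assms] positive_definite_mult_inv[OF assms])

lemma positive_definite_inv_inner_commute:
  fixes B :: "real^'n^'n"
  assumes "positive_definite B"
  shows "s \<bullet> (matrix_inv B *v t) = t \<bullet> (matrix_inv B *v s)"
  using positive_definite_inner_commute[OF assms, of "matrix_inv B *v s" "matrix_inv B *v t"]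
  by (simp add: positive_definite_mult_inv[OF assms])

text \<open>The cross term stays explicit: with \<open>s\<close> the error at the next point it is
  linear in that error and averages out.\<close>

lemma dual_norm_power2_diff:
  fixes B :: "real^'n^'n"
  assumes "positive_definite B"
  shows "(dual_norm B (s - t))\<^sup>2
    = (dual_norm B s)\<^sup>2 + (dual_norm B t)\<^sup>2 - 2 * (s \<bullet> (matrix_inv B *v t))"
  using positive_definite_inv_inner_commute[OF assms, of s t]
  by (simp add: dual_norm_power2[OF assms] matrix_vector_mult_diff_distrib inner_diff_left
      inner_diff_right)

text \<open>Completing the square: with \<open>v = matrix_inv B *v p\<close>, the quadratic form of
  \<open>B\<close> is nonnegative at \<open>v - c *\<^sub>R s\<close>; dividing by \<open>c\<close>
  gives the claim.\<close>

lemma fenchel_young_bnorm: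
  fixes B :: "real^'n^'n"
  assumes B: "positive_definite B" and c: "c > 0"
  shows "2 * (p \<bullet> s) - c * (bnorm B s)\<^sup>2 \<le> (dual_norm B p)\<^sup>2 / c"
proof -
  define v where "v = matrix_inv B *v p"
  have v: "B *v v = p" by (simp add: v_def positive_definite_mult_inv[OF B])
  have "0 \<le> (B *v (v - c *\<^sub>R s)) \<bullet> (v - c *\<^sub>R s)"
    by (rule positive_definite_nonneg[OF B])
  also have "\<dots> = p \<bullet> v - 2 * c * (p \<bullet> s) + c * c * ((B *v s) \<bullet> s)"
    using positive_definite_inner_commute[OF B, of s v]
    by (simp add: matrix_vector_mult_diff_distrib matrix_vector_mult_scaleR v inner_diff_left
        inner_diff_right algebra_simps)
  finally have "c * (2 * (p \<bullet> s) - c * (bnorm B s)\<^sup>2) \<le> (dual_norm B p)\<^sup>2"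
    by (simp add: bnorm_power2[OF B] dual_norm_power2[OF B] v_def algebra_simps)
  then show ?thesis using c by (simp add: pos_le_divide_eq mult.commute)
qed

section \<open>The solution of the stepsize equation in closed form\<close>

lemma stepsize_update_equation:
  assumes "\<Omega> > 0"
  shows "stepsize_equation B M \<Omega> x x' gx gx' (stepsize_update B M \<Omega> x x' gx gx')"
  unfolding stepsize_update_def by (rule theI'[OF stepsize_equation_unique_solution[OF assms]])

text \<open>Moving the multiple of the squared norm to the left makes the equation linear in
  \<open>m\<close>, with the positive part taken at the known \<open>M\<close>. Measurability and
  monotonicity can then be read off.\<close>

lemma stepsize_update_eq:
  assumes "\<Omega> > 0"
  shows "stepsize_update B M \<Omega> x x' gx gx' =
    M + max ((gx' - gx) \<bullet> (x' - x) - M / 2 * (bnorm B (x' - x))\<^sup>2) 0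
      / (\<Omega> + (bnorm B (x' - x))\<^sup>2 / 2)"
proof -
  define m where "m = stepsize_update B M \<Omega> x x' gx gx'"
  define a where "a = (gx' - gx) \<bullet> (x' - x)"
  define r where "r = (bnorm B (x' - x))\<^sup>2"
  have r: "r \<ge> 0" by (simp add: r_def)
  have eq: "(m - M) * \<Omega> = max (a - m / 2 * r) 0"
    using stepsize_update_equation[OF assms]
    by (simp add: stepsize_equation_def m_def a_def r_def)
  then have "(m - M) * \<Omega> \<ge> 0" by simp
  then have mM: "m \<ge> M" using assms by (simp add: zero_le_mult_iff)
  then have mr: "m * r \<ge> M * r" using r by (intro mult_right_mono) auto
  have split: "(m - M) * (\<Omega> + r / 2) = (m - M) * \<Omega> + (m * r - M * r) / 2"
    by (simp add: field_simps)
  have "(m - M) * (\<Omega> + r / 2) = max (a - M / 2 * r) 0"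
  \<comment> \<open>If the positive part is active at \<open>m\<close>, then
    \<open>M \<le> m\<close> makes it active at \<open>M\<close> too; if not, the equation forces
    \<open>m = M\<close>.\<close>
  proof (cases "a - m / 2 * r > 0")
    case True
    then show ?thesis using eq mr unfolding split by (simp add: diff_divide_distrib)
  next
    case False
    then have "m = M" using eq assms by simp
    then show ?thesis using False by simp
  qed
  then have "m = M + max (a - M / 2 * r) 0 / (\<Omega> + r / 2)"
    using assms r by (simp add: field_simps add_pos_nonneg)
  then show ?thesis by (simp add: m_def a_def r_def)
qed

lemma stepsize_update_ge:
  assumes "\<Omega> > 0"
  shows "stepsize_update B M \<Omega> x x' gx gx' \<ge> M"
  using assms by (simp add: stepsize_update_eq)

section \<open>Pointwise estimate for one update\<close>

text \<open>In the symmetric sum the linear terms combine to the difference of \<open>gbar\<close>,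
  leaving the gaps \<open>f - fbar\<close> at the two points. Each gap is
  \<open>\<beta> v v\<close>, hence between \<open>0\<close> and \<open>\<delta>\<close>. The last
  bound adds the smoothness inequality in both directions.\<close>

lemma approx_error_sum_bounds:
  assumes "approx_smooth B \<delta> L f fbar gbar"
  defines "\<beta> \<equiv> approx_error f fbar gbar"
  shows "\<beta> x y + \<beta> y x \<le> (gbar y - gbar x) \<bullet> (y - x) + 2 * \<delta>"
    and "(gbar y - gbar x) \<bullet> (y - x) \<le> \<beta> x y + \<beta> y x"
    and "\<beta> x y + \<beta> y x \<le> L * (bnorm B (y - x))\<^sup>2 + 2 * \<delta>"
proof -
  have b: "0 \<le> \<beta> v w \<and> \<beta> v w \<le> L / 2 * (bnorm B (v - w))\<^sup>2 + \<delta>" for v w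
    using assms(1) by (simp add: approx_smooth_def \<beta>_def)
  have diag: "0 \<le> f v - fbar v" "f v - fbar v \<le> \<delta>" for v
    using b[of v v] by (simp_all add: \<beta>_def approx_error_def bnorm_def)
  have eq: "\<beta> x y + \<beta> y x = (gbar y - gbar x) \<bullet> (y - x) + (f x - fbar x) + (f y - fbar y)"
    by (simp add: \<beta>_def approx_error_def inner_diff_left inner_diff_right)
  show "\<beta> x y + \<beta> y x \<le> (gbar y - gbar x) \<bullet> (y - x) + 2 * \<delta>"
    and "(gbar y - gbar x) \<bullet> (y - x) \<le> \<beta> x y + \<beta> y x"
    using diag[of x] diag[of y] by (simp_all add: eq)
  show "\<beta> x y + \<beta> y x \<le> L * (bnorm B (y - x))\<^sup>2 + 2 * \<delta>"
    using b[of x y] b[of y x] by (simp add: bnorm_minus_commute[of B x y])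
qed

text \<open>The inner product with \<open>gy - gbar y\<close> collects the two terms linear in the
  error at \<open>y\<close>: one from comparing with the positive part in the stepsize equation, the
  other the cross term of the squared dual norm. It is kept on the left so that it can be averaged
  away.\<close>

lemma stepsize_update_pointwise:
  fixes B :: "real^'n^'n" and x y gx gy :: "real^'n" and M :: real
  assumes B: "positive_definite B" and sm: "approx_smooth B \<delta> L f fbar gbar"
    and \<Omega>: "\<Omega> > 0" and K: "Mbar > 2 * L"
  defines "\<beta> \<equiv> approx_error f fbar gbar"
    and "m \<equiv> stepsize_update B M \<Omega> x y gx gy"
  shows "\<beta> x y + (gbar x - gx) \<bullet> (y - x) - m / 2 * (bnorm B (y - x))\<^sup>2 + (m - M) * \<Omega> + \<beta> y x
      + (gy - gbar y) \<bullet> (y - x + (2 / (Mbar - 2 * L)) *\<^sub>R (matrix_inv B *v (gx - gbar x)))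
    \<le> 6 * \<delta> + ((dual_norm B (gy - gbar y))\<^sup>2 + (dual_norm B (gx - gbar x))\<^sup>2) / (Mbar - 2 * L)
      + 2 * (max (min m Mbar - M) 0 * \<Omega>)"
proof -
  define c where "c = Mbar - 2 * L"
  have c: "c > 0" using K by (simp add: c_def)
  have d: "\<delta> \<ge> 0" using sm by (simp add: approx_smooth_def)
  define s where "s = y - x"
  define r where "r = (bnorm B s)\<^sup>2"
  have r: "r \<ge> 0" by (simp add: r_def)
  define \<sigma> where "\<sigma> = gy - gbar y"
  define \<tau> where "\<tau> = gx - gbar x"
  define h where "h = (gbar y - gbar x) \<bullet> s"
  define e where "e = \<beta> x y + \<beta> y x"
  define q where "q = (dual_norm B (\<sigma> - \<tau>))\<^sup>2 / c"
  have q0: "q \<ge> 0" using c by (simp add: q_def)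
  have e: "e \<le> h + 2 * \<delta>" "h \<le> e" "e \<le> L * r + 2 * \<delta>"
    using approx_error_sum_bounds[OF sm] by (simp_all add: e_def h_def s_def r_def \<beta>_def)
  define p where "p = max ((gy - gx) \<bullet> s - m / 2 * r) 0"
  have p: "(m - M) * \<Omega> = p"
    using stepsize_update_equation[OF \<Omega>, of B M x y gx gy]
    by (simp add: stepsize_equation_def m_def p_def s_def r_def)
  have mM: "m \<ge> M" unfolding m_def by (rule stepsize_update_ge[OF \<Omega>])
  have a: "(gy - gx) \<bullet> s = (\<sigma> - \<tau>) \<bullet> s + h"
    by (simp add: \<sigma>_def \<tau>_def h_def inner_diff_left)
  \<comment> \<open>The slack \<open>4 * \<delta> - 2 * (e - h)\<close> is nonnegative since
    \<open>e \<le> h + 2 * \<delta>\<close>, so both cases fit under one bound.\<close>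
  have key: "2 * p \<le> 2 * (max (min m Mbar - M) 0 * \<Omega>) + q + (4 * \<delta> - 2 * (e - h))"
  proof (cases "m \<le> Mbar")
    case True
    then show ?thesis using mM p q0 e(1) d by simp
  next
    case False
    have "Mbar * r \<le> m * r" using False r by (intro mult_right_mono) auto
    moreover have "2 * ((\<sigma> - \<tau>) \<bullet> s) - c * r \<le> q"
      unfolding q_def r_def by (rule fenchel_young_bnorm[OF B c])
    \<comment> \<open>This is where the factor 2 before \<open>L\<close> arises:
      \<open>2 * (L * r)\<close> pays for \<open>2 * e \<le> 2 * (L * r) + 4 * \<delta>\<close>, and
      \<open>c * r\<close> remains for Fenchel-Young.\<close>
    moreover have "c * r = Mbar * r - 2 * (L * r)" by (simp add: c_def algebra_simps)
    ultimately have "2 * ((gy - gx) \<bullet> s - m / 2 * r) \<le> q + (4 * \<delta> - 2 * (e - h))"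
      using e by (simp add: a)
    moreover have "0 \<le> q + (4 * \<delta> - 2 * (e - h))" using q0 e by simp
    moreover have "0 \<le> max (min m Mbar - M) 0 * \<Omega>" using \<Omega> by simp
    moreover have "p = (gy - gx) \<bullet> s - m / 2 * r \<or> p = 0" by (auto simp: p_def max_def)
    ultimately show ?thesis by auto
  qed
  \<comment> \<open>With \<open>p\<close>, this bounds the left-hand side by
    \<open>2 * p + (e - h)\<close> plus the cross term. Then \<open>key\<close> leaves
    \<open>4 * \<delta> - (e - h)\<close>, which is at most \<open>6 * \<delta>\<close> because
    \<open>h \<le> e\<close>.\<close>
  have "(gbar x - gx) \<bullet> s - m / 2 * r + \<sigma> \<bullet> s + h \<le> p"
    using a by (simp add: p_def \<sigma>_def \<tau>_def inner_diff_left)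
  moreover have "q + (2 / c) * (\<sigma> \<bullet> (matrix_inv B *v \<tau>))
      = ((dual_norm B \<sigma>)\<^sup>2 + (dual_norm B \<tau>)\<^sup>2) / c"
    by (simp add: q_def dual_norm_power2_diff[OF B] diff_divide_distrib)
  ultimately show ?thesis
    using key p e d unfolding c_def[symmetric] s_def[symmetric] r_def[symmetric]
      \<sigma>_def[symmetric] \<tau>_def[symmetric]
    by (simp add: inner_add_right e_def)
qed

section \<open>Measurability of the update\<close>

lemma borel_measurable_matrix_vector_mult [measurable (raw)]:
  fixes A :: "real^'n^'m"
  assumes "h \<in> borel_measurable M"
  shows "(\<lambda>\<omega>. A *v h \<omega>) \<in> borel_measurable M"
  by (rule measurable_compose[OF assms])
    (intro borel_measurable_continuous_onI matrix_vector_mult_linear_continuous_on)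

lemma borel_measurable_bnorm [measurable (raw)]:
  assumes [measurable]: "h \<in> borel_measurable M"
  shows "(\<lambda>\<omega>. bnorm B (h \<omega>)) \<in> borel_measurable M"
  unfolding bnorm_def by measurable

lemma borel_measurable_stepsize_update:
  assumes "\<Omega> > 0"
    and [measurable]: "X \<in> borel_measurable P" "gx \<in> borel_measurable P" "gX \<in> borel_measurable P"
  shows "(\<lambda>\<omega>. stepsize_update B M \<Omega> x (X \<omega>) (gx \<omega>) (gX \<omega>)) \<in> borel_measurable P"
  unfolding stepsize_update_eq[OF assms(1)] by measurable

section \<open>Averaging the pointwise estimate\<close>

theorem lemma21:
  fixes B :: "real^'n^'n"
    and \<psi> :: "real^'n \<Rightarrow> ereal"
    and f fbar :: "real^'n \<Rightarrow> real"
    and gbar :: "real^'n \<Rightarrow> real^'n"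
    and \<delta> L :: real
    and D :: "'s measure"
    and g :: "real^'n \<Rightarrow> 's \<Rightarrow> real^'n"
    and P :: "'w measure"
  assumes "positive_definite B"
    and "proper_closed_convex \<psi>"
    and "convex_on UNIV f"
    and "approx_smooth B \<delta> L f fbar gbar"
    and "stochastic_oracle D g"
    and "unbiased_oracle D g gbar"
    and "prob_space P"
  shows "stepsize_requirement P B \<psi> \<delta> L f fbar gbar D g (stepsize_update B) 1 2 6 2"
proof -
  note B = assms(1) and sm = assms(4) and P = assms(7)
  interpret prob_space P by (rule P)
  interpret D: prob_space D using assms(5) by (simp add: stochastic_oracle_def)
  have g[measurable]: "(\<lambda>(x, \<xi>). g x \<xi>) \<in> borel_measurable (borel \<Otimes>\<^sub>M D)"
    using assms(5) by (simp add: stochastic_oracle_def)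
  have gint: "integrable D (g x)" and gmean: "gbar x = (\<integral>\<xi>. g x \<xi> \<partial>D)" for x
    using assms(6) by (simp_all add: unbiased_oracle_def)
  \<comment> \<open>By unbiasedness, \<open>gbar\<close> is a parameter integral of the jointly
    measurable \<open>g\<close>.\<close>
  have gbar[measurable]: "gbar \<in> borel_measurable borel"
    unfolding gmean by measurable
  have d: "\<delta> \<ge> 0" using sm by (simp add: approx_smooth_def)
  define Var where "Var = oracle_variance B D g gbar"
  have Var[measurable]: "Var \<in> borel_measurable borel"
    unfolding Var_def oracle_variance_def dual_norm_power2[OF B] by measurable
  have main: "extended_expectation P lhs
      \<le> ereal (1 / (Mbar - 2 * L)) * enn2ereal (\<integral>\<^sup>+\<omega>. Var (X \<omega>) + Var x \<partial>P) + ereal (6 * \<delta>)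
        + ereal 2 * extended_expectation P (\<lambda>\<omega>. max (min (m \<omega>) Mbar - M) 0 * \<Omega>)"
    if \<Omega>: "\<Omega> > 0"
      and \<xi>1[measurable]: "\<xi>\<^sub>1 \<in> measurable P D" and d1: "distr P D \<xi>\<^sub>1 = D"
      and X[measurable]: "X \<in> borel_measurable P"
      and \<xi>2[measurable]: "\<xi>\<^sub>2 \<in> measurable P D" and d2: "distr P D \<xi>\<^sub>2 = D"
      and ind: "indep_random_variables P (D \<Otimes>\<^sub>M borel) (\<lambda>\<omega>. (\<xi>\<^sub>1 \<omega>, X \<omega>)) D \<xi>\<^sub>2"
      and m: "m = (\<lambda>\<omega>. stepsize_update B M \<Omega> x (X \<omega>) (g x (\<xi>\<^sub>1 \<omega>)) (g (X \<omega>) (\<xi>\<^sub>2 \<omega>)))"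
      and lhs: "lhs = (\<lambda>\<omega>. approx_error f fbar gbar x (X \<omega>)
        + (gbar x - g x (\<xi>\<^sub>1 \<omega>)) \<bullet> (X \<omega> - x) - m \<omega> / 2 * (bnorm B (X \<omega> - x))\<^sup>2
        + (m \<omega> - M) * \<Omega> + approx_error f fbar gbar (X \<omega>) x)"
      and he: "has_expectation P lhs" and K: "Mbar > 2 * L"
    for M \<Omega> x \<xi>\<^sub>1 X \<xi>\<^sub>2 m lhs Mbar
  proof -
    define c where "c = Mbar - 2 * L"
    have c: "c > 0" using K by (simp add: c_def)
    have m_meas[measurable]: "m \<in> borel_measurable P"
      unfolding m by (rule borel_measurable_stepsize_update[OF \<Omega>]) measurable
    define \<sigma> where "\<sigma> \<omega> = (dual_norm B (g (X \<omega>) (\<xi>\<^sub>2 \<omega>) - gbar (X \<omega>)))\<^sup>2" for \<omega>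
    define \<tau> where "\<tau> \<omega> = (dual_norm B (g x (\<xi>\<^sub>1 \<omega>) - gbar x))\<^sup>2" for \<omega>
    define b where "b \<omega> = max (min (m \<omega>) Mbar - M) 0 * \<Omega>" for \<omega>
    define z where "z \<omega> = 6 * \<delta> + (\<sigma> \<omega> + \<tau> \<omega>) / c + 2 * b \<omega>" for \<omega>
    \<comment> \<open>For fixed \<open>(w, y)\<close> this is linear in the centered query error.
      The other factor involves only \<open>\<xi>\<^sub>1\<close> and \<open>X\<close>, of which
      \<open>\<xi>\<^sub>2\<close> is independent.\<close>
    define k where "k = (\<lambda>(w, y) \<xi>.
      (g y \<xi> - gbar y) \<bullet> (y - x + (2 / c) *\<^sub>R (matrix_inv B *v (g x w - gbar x))))"
    have meas[measurable]: "\<sigma> \<in> borel_measurable P" "\<tau> \<in> borel_measurable P" "b \<in> borel_measurable P"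
      unfolding \<sigma>_def \<tau>_def b_def dual_norm_power2[OF B] by measurable
    have nn: "\<sigma> \<omega> \<ge> 0" "\<tau> \<omega> \<ge> 0" "b \<omega> \<ge> 0" for \<omega>
      using \<Omega> by (simp_all add: \<sigma>_def \<tau>_def b_def)
    have gintK: "integrable D (\<lambda>\<xi>. g y \<xi> - gbar y)" for y
      using gint by simp
    have "(\<integral>\<^sup>+\<omega>. ennreal (lhs \<omega>) \<partial>P) \<le> (\<integral>\<^sup>+\<omega>. ennreal (z \<omega>) \<partial>P) + (\<integral>\<^sup>+\<omega>. ennreal (- lhs \<omega>) \<partial>P)"
    proof (rule nn_integral_le_add_centered[OF P ind, where k = k])
      show "case_prod k \<in> borel_measurable ((D \<Otimes>\<^sub>M borel) \<Otimes>\<^sub>M D)"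
        unfolding k_def split_beta' by measurable
      show "integrable (distr P D \<xi>\<^sub>2) (k p)" for p
        unfolding d2 k_def by (cases p) (simp add: gintK)
      show "(\<integral>\<xi>. k p \<xi> \<partial>distr P D \<xi>\<^sub>2) = 0" for p
        unfolding d2 k_def by (cases p) (simp add: gintK gint gmean[symmetric] D.prob_space)
      show "lhs \<in> borel_measurable P" using he by (simp add: has_expectation_def)
      show "z \<in> borel_measurable P" unfolding z_def by measurable
      show "0 \<le> z \<omega>" for \<omega> using c d nn by (simp add: z_def)
      show "lhs \<omega> + k (\<xi>\<^sub>1 \<omega>, X \<omega>) (\<xi>\<^sub>2 \<omega>) \<le> z \<omega>" for \<omega>
        using stepsize_update_pointwise[OF B sm \<Omega> K, of x "X \<omega>" "g x (\<xi>\<^sub>1 \<omega>)" M "g (X \<omega>) (\<xi>\<^sub>2 \<omega>)"]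
        by (simp add: lhs m k_def z_def c_def \<sigma>_def \<tau>_def b_def)
    qed
    then have le: "extended_expectation P lhs \<le> enn2ereal (\<integral>\<^sup>+\<omega>. ennreal (z \<omega>) \<partial>P)"
      by (rule extended_expectation_leI[OF he])
    \<comment> \<open>Averaging over \<open>\<xi>\<^sub>2\<close> with \<open>X\<close> held fixed
      gives the variance at the random point.\<close>
    have "(\<integral>\<^sup>+\<omega>. ennreal (\<sigma> \<omega>) \<partial>P) = (\<integral>\<^sup>+\<omega>. Var (X \<omega>) \<partial>P)"
      using nn_integral_indep_random_variables[OF P ind,
          of "\<lambda>p \<xi>. ennreal ((dual_norm B (g (snd p) \<xi> - gbar (snd p)))\<^sup>2)"]
      by (simp add: d2 split_beta' \<sigma>_def Var_def oracle_variance_def dual_norm_power2[OF B])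
    moreover have "(\<integral>\<^sup>+\<omega>. ennreal (\<tau> \<omega>) \<partial>P) = Var x"
    proof -
      have "Var x = (\<integral>\<^sup>+\<xi>. ennreal ((dual_norm B (g x \<xi> - gbar x))\<^sup>2) \<partial>distr P D \<xi>\<^sub>1)"
        by (simp add: d1 Var_def oracle_variance_def)
      also have "\<dots> = (\<integral>\<^sup>+\<omega>. ennreal (\<tau> \<omega>) \<partial>P)"
        unfolding \<tau>_def dual_norm_power2[OF B] by (subst nn_integral_distr) simp_all
      finally show ?thesis by simp
    qed
    ultimately have V: "(\<integral>\<^sup>+\<omega>. ennreal (\<sigma> \<omega>) + ennreal (\<tau> \<omega>) \<partial>P) = (\<integral>\<^sup>+\<omega>. Var (X \<omega>) + Var x \<partial>P)"
      by (simp add: nn_integral_add emeasure_space_1)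
    \<comment> \<open>All summands of \<open>z\<close> are nonnegative, so the integral splits in
      \<open>ennreal\<close> even when the variances are infinite.\<close>
    have "(\<integral>\<^sup>+\<omega>. ennreal (z \<omega>) \<partial>P)
        = (\<integral>\<^sup>+\<omega>. ennreal (1 / c) * (ennreal (\<sigma> \<omega>) + ennreal (\<tau> \<omega>)) + ennreal (6 * \<delta>)
            + ennreal 2 * ennreal (b \<omega>) \<partial>P)"
      using c d nn
      by (intro nn_integral_cong)
        (simp add: z_def ennreal_plus[symmetric] ennreal_mult[symmetric] add.commute
          del: ennreal_plus ennreal_numeral)
    also have "\<dots> = ennreal (1 / c) * (\<integral>\<^sup>+\<omega>. Var (X \<omega>) + Var x \<partial>P) + ennreal (6 * \<delta>)
        + ennreal 2 * (\<integral>\<^sup>+\<omega>. ennreal (b \<omega>) \<partial>P)"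
      by (simp add: V[symmetric] nn_integral_add nn_integral_cmult emeasure_space_1
          del: ennreal_numeral)
    finally have "enn2ereal (\<integral>\<^sup>+\<omega>. ennreal (z \<omega>) \<partial>P)
        = ereal (1 / c) * enn2ereal (\<integral>\<^sup>+\<omega>. Var (X \<omega>) + Var x \<partial>P) + ereal (6 * \<delta>)
          + ereal 2 * extended_expectation P b"
      using c d nn by (simp add: extended_expectation_nonneg plus_ennreal.rep_eq
          times_ennreal.rep_eq del: ennreal_numeral)
    with le show ?thesis by (simp add: c_def b_def[abs_def])
  qed
  show ?thesis
    unfolding stepsize_requirement_def Let_def Var_def[symmetric]
  proof (intro conjI allI impI; (elim conjE)?)
    fix M \<Omega> x \<xi>\<^sub>1 \<xi>\<^sub>2 and X :: "'w \<Rightarrow> real^'n"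
    assume \<Omega>: "(\<Omega>::real) > 0"
      and [measurable]: "\<xi>\<^sub>1 \<in> measurable P D" "X \<in> borel_measurable P" "\<xi>\<^sub>2 \<in> measurable P D"
    show "(\<lambda>\<omega>. stepsize_update B M \<Omega> x (X \<omega>) (g x (\<xi>\<^sub>1 \<omega>)) (g (X \<omega>) (\<xi>\<^sub>2 \<omega>))) \<in> borel_measurable P"
      by (rule borel_measurable_stepsize_update[OF \<Omega>]) measurable
    show "\<forall>\<omega>\<in>space P. M \<le> stepsize_update B M \<Omega> x (X \<omega>) (g x (\<xi>\<^sub>1 \<omega>)) (g (X \<omega>) (\<xi>\<^sub>2 \<omega>))"
      by (simp add: stepsize_update_ge[OF \<Omega>])
  next
    show "(1::real) > 0" "(2::real) > 0" "(6::real) > 0" "(2::real) > 0" by simp_all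
  qed (rule main[OF _ _ _ _ _ _ _ refl refl]; assumption)
qed

end
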